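(* Let $G$ be a finite group and suppose $(S,T)$ is an $(s,t)$-$\lambda$-fold near-factorization of $G$, where $|G|=s+t+1$. Then $S$ is translate-equivalent to an $(s+t+1,s,s-\lambda-1,s-\lambda)$-partial difference set in $G$, and $T$ is translate-equivalent to an $(s+t+1,t,t-\lambda-1,t-\lambda)$-partial difference set in $G$.
   Context: Subsets of $G$ are identified with the sums of their elements in the group ring $\mathbb{Z}[G]$; $e$ is the identity of $G$; for a subset $D$, $D^{(-1)}=\{d^{-1}:d\in D\}$. A $(v,k,\alpha,\mu)$-partial difference set in a group $G$ of order $v$ is a subset $D\subseteq G\setminus\{e\}$ with $|D|=k$ and $DD^{(-1)}=(k-\mu)\cdot e+(\alpha-\mu)D+\mu G$ in $\mathbb{Z}[G]$. For $S,T\subseteq G$ and a positive integer $\lambda$, $(S,T)$ is an $(s,t)$-$\lambda$-fold near-factorization of $G$ if $|S|=s$, $|T|=t$ and $ST=\lambda(G-e)$ in $\mathbb{Z}[G]$; that is, every non-identity element of $G$ can be written as $xy$ with $x\in S$, $y\in T$ in exactly $\lambda$ ways, and $xy\ne e$ for all $x\in S,y\in T$. A subset $B\subseteq G$ is translate-equivalent to $A\subseteq G$ if there is $g\in G$ with $B=gA$ (left translate-equivalent) or $B=Ag$ (right translate-equivalent). *)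

theory Defs
  imports "HOL-Algebra.Coset" "HOL-Algebra.Ring" "HOL-Library.Indicator_Function"
begin

text \<open>
  The integral group ring of a finite group: elements are the coefficient functions, forced to
  vanish outside the carrier so that equality in the ring is equality of functions, and the product
  is convolution. A subset \<open>A\<close> of the group, read as the sum of its elements, is \<open>indicator A\<close>.
  For infinite groups this is not the group ring (no finite-support condition is imposed).
\<close>

definition group_ring :: "('a, 'b) monoid_scheme \<Rightarrow> ('a \<Rightarrow> int) ring" where
  "group_ring G =
    \<lparr> carrier = {f. \<forall>x. x \<notin> carrier G \<longrightarrow> f x = 0},
      mult = (\<lambda>f g x. \<Sum>(y, z) \<in> {(y, z). y \<in> carrier G \<and> z \<in> carrier G \<and> y \<otimes>\<^bsub>G\<^esub> z = x}. f y * g z),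
      one = indicator {\<one>\<^bsub>G\<^esub>},
      zero = (\<lambda>x. 0),
      add = (\<lambda>f g x. f x + g x) \<rparr>"

text \<open>
  The parameters \<open>\<alpha>\<close> and \<open>\<mu>\<close> are integers, so that expressions such as \<open>s - \<lambda> - 1\<close> are
  never truncated.
\<close>

definition partial_difference_set ::
  "('a, 'b) monoid_scheme \<Rightarrow> nat \<Rightarrow> nat \<Rightarrow> int \<Rightarrow> int \<Rightarrow> 'a set \<Rightarrow> bool" where
  "partial_difference_set G v k \<alpha> \<mu> D \<longleftrightarrow>
    order G = v \<and> D \<subseteq> carrier G - {\<one>\<^bsub>G\<^esub>} \<and> card D = k \<and>
    indicator D \<otimes>\<^bsub>group_ring G\<^esub> indicator (set_inv\<^bsub>G\<^esub> D) =
      [(int k - \<mu>)] \<cdot>\<^bsub>group_ring G\<^esub> \<one>\<^bsub>group_ring G\<^esub>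
      \<oplus>\<^bsub>group_ring G\<^esub> [(\<alpha> - \<mu>)] \<cdot>\<^bsub>group_ring G\<^esub> indicator D
      \<oplus>\<^bsub>group_ring G\<^esub> [\<mu>] \<cdot>\<^bsub>group_ring G\<^esub> indicator (carrier G)"

definition near_factorization ::
  "('a, 'b) monoid_scheme \<Rightarrow> nat \<Rightarrow> nat \<Rightarrow> nat \<Rightarrow> 'a set \<Rightarrow> 'a set \<Rightarrow> bool" where
  "near_factorization G s t l S T \<longleftrightarrow>
    l > 0 \<and> S \<subseteq> carrier G \<and> T \<subseteq> carrier G \<and> card S = s \<and> card T = t \<and>
    indicator S \<otimes>\<^bsub>group_ring G\<^esub> indicator T =
      [l] \<cdot>\<^bsub>group_ring G\<^esub> (indicator (carrier G) \<ominus>\<^bsub>group_ring G\<^esub> \<one>\<^bsub>group_ring G\<^esub>)"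

definition translate_equivalent :: "('a, 'b) monoid_scheme \<Rightarrow> 'a set \<Rightarrow> 'a set \<Rightarrow> bool" where
  "translate_equivalent G B A \<longleftrightarrow>
    (\<exists>g \<in> carrier G. B = g <#\<^bsub>G\<^esub> A \<or> B = A #>\<^bsub>G\<^esub> g)"

lemma (in group) group_ring_mult_eq:
  assumes "x \<in> carrier G"
  shows "(f \<otimes>\<^bsub>group_ring G\<^esub> g) x = (\<Sum>y\<in>carrier G. f y * g (inv y \<otimes> x))"
proof -
  have "(f \<otimes>\<^bsub>group_ring G\<^esub> g) x =
      (\<Sum>(y, z) \<in> (\<lambda>y. (y, inv y \<otimes> x)) ` carrier G. f y * g z)"
    unfolding group_ring_def using assms
    by (auto intro!: sum.cong simp: m_assoc[symmetric] image_iff inv_solve_left)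
  also have "\<dots> = (\<Sum>y\<in>carrier G. f y * g (inv y \<otimes> x))"
    by (subst sum.reindex) (auto intro: inj_onI)
  finally show ?thesis .
qed

lemma group_ring_mult_outside:
  assumes "group G" "x \<notin> carrier G"
  shows "(f \<otimes>\<^bsub>group_ring G\<^esub> g) x = 0"
proof -
  interpret group G by fact
  show ?thesis
    unfolding group_ring_def by (auto intro!: sum.neutral simp: assms(2)) (use assms in auto)
qed

lemma (in group) ring_group_ring:
  assumes fin: "finite (carrier G)"
  shows "ring (group_ring G)"
proof (rule ringI)
  let ?R = "group_ring G"
  show "abelian_group ?R"
  proof (rule abelian_groupI)
    fix f assume "f \<in> carrier ?R"
    then show "\<exists>g\<in>carrier ?R. g \<oplus>\<^bsub>?R\<^esub> f = \<zero>\<^bsub>?R\<^esub>"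
      by (intro bexI[of _ "\<lambda>x. - f x"]) (auto simp: group_ring_def)
  qed (auto simp: group_ring_def)
  have closed: "f \<otimes>\<^bsub>?R\<^esub> g \<in> carrier ?R" for f g
    using group_ring_mult_outside[OF is_group] by (simp add: group_ring_def)
  have outside: "f x = 0" if "f \<in> carrier ?R" "x \<notin> carrier G" for f x
    using that by (simp add: group_ring_def)
  show "monoid ?R"
  proof (rule monoidI)
    fix f g h assume "f \<in> carrier ?R" "g \<in> carrier ?R" "h \<in> carrier ?R"
    show "f \<otimes>\<^bsub>?R\<^esub> g \<otimes>\<^bsub>?R\<^esub> h = f \<otimes>\<^bsub>?R\<^esub> (g \<otimes>\<^bsub>?R\<^esub> h)"
    proof
      fix x
      show "(f \<otimes>\<^bsub>?R\<^esub> g \<otimes>\<^bsub>?R\<^esub> h) x = (f \<otimes>\<^bsub>?R\<^esub> (g \<otimes>\<^bsub>?R\<^esub> h)) x"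
      proof (cases "x \<in> carrier G")
        case True
        have "(f \<otimes>\<^bsub>?R\<^esub> g \<otimes>\<^bsub>?R\<^esub> h) x =
            (\<Sum>z\<in>carrier G. (\<Sum>y\<in>carrier G. f y * g (inv y \<otimes> z)) * h (inv z \<otimes> x))"
          using True by (simp add: group_ring_mult_eq)
        also have "\<dots> = (\<Sum>y\<in>carrier G. \<Sum>z\<in>carrier G. f y * g (inv y \<otimes> z) * h (inv z \<otimes> x))"
          by (simp add: sum_distrib_right) (rule sum.swap)
        also have "\<dots> = (\<Sum>y\<in>carrier G. \<Sum>w\<in>carrier G. f y * g w * h (inv w \<otimes> (inv y \<otimes> x)))"
        proof (rule sum.cong[OF refl])
          fix y assume y: "y \<in> carrier G"
          have cancel: "y \<otimes> (inv y \<otimes> w) = w" "inv y \<otimes> (y \<otimes> w) = w" if "w \<in> carrier G" for w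
            using that y by (simp_all add: m_assoc[symmetric])
          show "(\<Sum>z\<in>carrier G. f y * g (inv y \<otimes> z) * h (inv z \<otimes> x)) =
              (\<Sum>w\<in>carrier G. f y * g w * h (inv w \<otimes> (inv y \<otimes> x)))"
            by (rule sum.reindex_bij_witness[of _ "\<lambda>w. y \<otimes> w" "\<lambda>z. inv y \<otimes> z"])
              (use y True in \<open>auto simp: cancel m_assoc inv_mult_group\<close>)
        qed
        also have "\<dots> = (f \<otimes>\<^bsub>?R\<^esub> (g \<otimes>\<^bsub>?R\<^esub> h)) x"
          using True by (simp add: group_ring_mult_eq sum_distrib_left mult.assoc)
        finally show ?thesis .
      qed (simp add: group_ring_mult_outside[OF is_group])
    qed
  next
    fix f assume f: "f \<in> carrier ?R"
    show "\<one>\<^bsub>?R\<^esub> \<otimes>\<^bsub>?R\<^esub> f = f"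
    proof
      fix x
      show "(\<one>\<^bsub>?R\<^esub> \<otimes>\<^bsub>?R\<^esub> f) x = f x"
      proof (cases "x \<in> carrier G")
        case True
        have "(\<one>\<^bsub>?R\<^esub> \<otimes>\<^bsub>?R\<^esub> f) x = (\<Sum>y\<in>carrier G. if y = \<one> then f x else 0)"
          unfolding group_ring_mult_eq[OF True]
          by (rule sum.cong) (use True in \<open>auto simp: group_ring_def\<close>)
        then show ?thesis using fin by simp
      qed (simp add: group_ring_mult_outside[OF is_group] outside[OF f])
    qed
    show "f \<otimes>\<^bsub>?R\<^esub> \<one>\<^bsub>?R\<^esub> = f"
    proof
      fix x
      show "(f \<otimes>\<^bsub>?R\<^esub> \<one>\<^bsub>?R\<^esub>) x = f x"
      proof (cases "x \<in> carrier G")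
        case True
        have "inv y \<otimes> x = \<one> \<longleftrightarrow> y = x" if "y \<in> carrier G" for y
          using that True by (metis inv_solve_left one_closed r_one)
        then have "(f \<otimes>\<^bsub>?R\<^esub> \<one>\<^bsub>?R\<^esub>) x = (\<Sum>y\<in>carrier G. if y = x then f x else 0)"
          unfolding group_ring_mult_eq[OF True]
          by (intro sum.cong) (auto simp: group_ring_def indicator_def)
        then show ?thesis using fin True by simp
      qed (simp add: group_ring_mult_outside[OF is_group] outside[OF f])
    qed
  qed (use closed in \<open>auto simp: group_ring_def indicator_def\<close>)
qed (auto simp: group_ring_def fun_eq_iff sum.distrib algebra_simps split_beta)

lemma (in group) group_ring_a_minus:
  assumes "finite (carrier G)" "f \<in> carrier (group_ring G)" "g \<in> carrier (group_ring G)"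
  shows "f \<ominus>\<^bsub>group_ring G\<^esub> g = (\<lambda>x. f x - g x)"
proof -
  interpret R: ring "group_ring G" by (rule ring_group_ring) fact
  have "\<ominus>\<^bsub>group_ring G\<^esub> g = (\<lambda>x. - g x)"
    using assms by (intro R.minus_equality) (auto simp: group_ring_def)
  then show ?thesis by (simp add: a_minus_def group_ring_def)
qed

lemma group_ring_add_pow_nat: "[(n :: nat)] \<cdot>\<^bsub>group_ring G\<^esub> f = (\<lambda>x. int n * f x)"
  by (induction n) (auto simp: add_pow_def group_ring_def nat_pow_def algebra_simps)

lemma (in group) group_ring_add_pow_int:
  assumes "finite (carrier G)" "f \<in> carrier (group_ring G)"
  shows "[(k :: int)] \<cdot>\<^bsub>group_ring G\<^esub> f = (\<lambda>x. k * f x)"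
proof (cases "k \<ge> 0")
  case True
  then show ?thesis by (simp add: add_pow_int_ge group_ring_add_pow_nat)
next
  case False
  interpret R: ring "group_ring G" by (rule ring_group_ring) fact
  have "\<ominus>\<^bsub>group_ring G\<^esub> (\<lambda>x. - k * f x) = (\<lambda>x. k * f x)"
    using assms by (intro R.minus_equality) (auto simp: group_ring_def)
  with False show ?thesis by (simp add: add_pow_int_lt group_ring_add_pow_nat)
qed

lemma (in group) group_ring_mult_indicator:
  assumes "finite (carrier G)" "A \<subseteq> carrier G" "B \<subseteq> carrier G"
  shows "(indicator A \<otimes>\<^bsub>group_ring G\<^esub> indicator B) x =
    int (card {(a, b). a \<in> A \<and> b \<in> B \<and> a \<otimes> b = x})"
proof -
  let ?P = "{(y, z). y \<in> carrier G \<and> z \<in> carrier G \<and> y \<otimes> z = x}"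
  let ?Q = "{(a, b). a \<in> A \<and> b \<in> B \<and> a \<otimes> b = x}"
  have "finite ?P"
    by (rule finite_subset[of _ "carrier G \<times> carrier G"]) (use assms in auto)
  moreover have "?Q \<subseteq> ?P" using assms by auto
  moreover have "(indicator A \<otimes>\<^bsub>group_ring G\<^esub> indicator B) x = (\<Sum>p\<in>?P. indicator ?Q p)"
    unfolding group_ring_def by (auto intro!: sum.cong simp: indicator_def)
  ultimately show ?thesis
    by (simp add: indicator_def Int_absorb1 sum.If_cases flip: of_nat_sum)
qed

end

theory Submission
  imports Defs
begin

text \<open>
  Since \<open>xy \<noteq> e\<close> for \<open>x \<in> S\<close>, \<open>y \<in> T\<close>, the sets \<open>S\<^sup>-\<^sup>1\<close> and \<open>T\<close> are disjoint, so \<open>|G| = s + t + 1\<close>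
  leaves exactly one further element \<open>g\<close>, and \<open>S\<^sup>-\<^sup>1 = G - T - g\<close> in the group ring. Multiplying by
  \<open>S\<close> from the left gives \<open>SS\<^sup>-\<^sup>1 = \<lambda>e - Sg + (s - \<lambda>)G\<close>, and \<open>SS\<^sup>-\<^sup>1 = DD\<^sup>-\<^sup>1\<close> for \<open>D = Sg\<close>.
  Inversion is an anti-automorphism, so \<open>(T\<^sup>-\<^sup>1, S\<^sup>-\<^sup>1)\<close> is a near-factorization as well and some
  \<open>D = T\<^sup>-\<^sup>1h\<close> is a partial difference set. As \<open>DD\<^sup>-\<^sup>1\<close> is invariant under inversion and \<open>D\<close> occurs
  in it with coefficient \<open>-1\<close>, also \<open>D = D\<^sup>-\<^sup>1 = h\<^sup>-\<^sup>1T\<close>.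
\<close>

lemma indicator_in_group_ring: "A \<subseteq> carrier G \<Longrightarrow> indicator A \<in> carrier (group_ring G)"
  by (auto simp: group_ring_def indicator_def)

context group
begin

section \<open>Inverses and translates of subsets\<close>

lemma mem_set_inv_iff:
  assumes "A \<subseteq> carrier G" "x \<in> carrier G"
  shows "x \<in> set_inv A \<longleftrightarrow> inv x \<in> A"
proof
  assume "inv x \<in> A"
  moreover have "x = inv (inv x)" using assms by simp
  ultimately show "x \<in> set_inv A" unfolding SET_INV_def by blast
qed (use assms in \<open>auto simp: SET_INV_def subset_iff\<close>)

lemma set_inv_subset: "A \<subseteq> carrier G \<Longrightarrow> set_inv A \<subseteq> carrier G"
  by (auto simp: SET_INV_def)

lemma set_inv_set_inv:
  assumes "A \<subseteq> carrier G"
  shows "set_inv (set_inv A) = A"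
proof -
  have A': "set_inv A \<subseteq> carrier G" using assms by (rule set_inv_subset)
  have "x \<in> set_inv (set_inv A) \<longleftrightarrow> x \<in> A" if "x \<in> carrier G" for x
    using that by (simp add: mem_set_inv_iff[OF assms] mem_set_inv_iff[OF A'])
  then show ?thesis using assms set_inv_subset[OF A'] by auto
qed

lemma card_set_inv: "A \<subseteq> carrier G \<Longrightarrow> card (set_inv A) = card A"
proof -
  assume A: "A \<subseteq> carrier G"
  then have "inj_on (\<lambda>x. inv x) A" by (meson inj_on_subset inv_inj)
  moreover have "set_inv A = (\<lambda>x. inv x) ` A" by (auto simp: SET_INV_def)
  ultimately show ?thesis by (simp add: card_image)
qed

lemma mem_r_coset_iff:
  assumes "A \<subseteq> carrier G" "g \<in> carrier G" "x \<in> carrier G"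
  shows "x \<in> A #> g \<longleftrightarrow> x \<otimes> inv g \<in> A"
  using assms by (force simp: r_coset_def m_assoc)

lemma mem_l_coset_iff:
  assumes "A \<subseteq> carrier G" "g \<in> carrier G" "x \<in> carrier G"
  shows "x \<in> g <# A \<longleftrightarrow> inv g \<otimes> x \<in> A"
proof
  assume "inv g \<otimes> x \<in> A"
  moreover have "g \<otimes> (inv g \<otimes> x) = x" using assms by (simp add: m_assoc[symmetric])
  ultimately show "x \<in> g <# A" unfolding l_coset_def by force
next
  assume "x \<in> g <# A"
  then show "inv g \<otimes> x \<in> A"
    using assms by (force simp: l_coset_def m_assoc[symmetric])
qed

text \<open>Inversion reverses products, so a right translate turns into a left one. This is how a
  left translate of \<open>T\<close> arises in the theorem.\<close>

lemma set_inv_r_coset: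
  assumes "A \<subseteq> carrier G" "g \<in> carrier G"
  shows "set_inv (A #> g) = inv g <# set_inv A"
  using assms by (auto simp: SET_INV_def r_coset_def l_coset_def inv_mult_group subset_iff)

lemma inj_on_r_translation:
  assumes "A \<subseteq> carrier G" "g \<in> carrier G"
  shows "inj_on (\<lambda>a. a \<otimes> g) A"
  using assms by (auto intro!: inj_onI simp: subset_iff)

lemma r_coset_eq_image: "A #> g = (\<lambda>a. a \<otimes> g) ` A"
  by (auto simp: r_coset_def)

section \<open>Coefficients of products of subsets\<close>

text \<open>Terms whose first factor lies outside \<open>A\<close> vanish. \<open>B\<close> enters
  only through values of its indicator, so an identity between indicators can be substituted under
  the sum.\<close>

lemma group_ring_mult_indicator_sum:
  assumes "finite (carrier G)" "A \<subseteq> carrier G" "x \<in> carrier G"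
  shows "(indicator A \<otimes>\<^bsub>group_ring G\<^esub> indicator B) x = (\<Sum>a\<in>A. indicator B (inv a \<otimes> x))"
  unfolding group_ring_mult_eq[OF assms(3)]
  by (rule sum.mono_neutral_cong_right) (use assms in auto)

text \<open>Inverting and swapping the factors matches the ways to write \<open>inv x\<close> as a
  product from \<open>A\<close> and \<open>B\<close> with the ways to write \<open>x\<close> as a
  product from \<open>set_inv B\<close> and \<open>set_inv A\<close>.\<close>

lemma group_ring_mult_set_inv:
  assumes "finite (carrier G)" "A \<subseteq> carrier G" "B \<subseteq> carrier G" "x \<in> carrier G"
  shows "(indicator (set_inv B) \<otimes>\<^bsub>group_ring G\<^esub> indicator (set_inv A)) x =
    (indicator A \<otimes>\<^bsub>group_ring G\<^esub> indicator B) (inv x)"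
proof -
  have "bij_betw (\<lambda>(b, a). (inv a, inv b))
      {(b, a). b \<in> set_inv B \<and> a \<in> set_inv A \<and> b \<otimes> a = x}
      {(a, b). a \<in> A \<and> b \<in> B \<and> a \<otimes> b = inv x}"
    by (rule bij_betwI[where g = "\<lambda>(a, b). (inv b, inv a)"])
      (use assms in \<open>auto simp: SET_INV_def inv_mult_group[symmetric] subset_iff\<close>)
  then show ?thesis
    using assms by (simp add: group_ring_mult_indicator set_inv_subset bij_betw_same_card)
qed

section \<open>The two notions, coefficient by coefficient\<close>

text \<open>Both sides of the ring equation vanish outside the carrier, so it can be compared
  pointwise on \<open>carrier G\<close>, whose indicator is 1 there.\<close>

lemma near_factorization_iff:
  assumes fin: "finite (carrier G)"
  shows "near_factorization G s t l S T \<longleftrightarrow>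
    l > 0 \<and> S \<subseteq> carrier G \<and> T \<subseteq> carrier G \<and> card S = s \<and> card T = t \<and>
    (\<forall>x\<in>carrier G. (indicator S \<otimes>\<^bsub>group_ring G\<^esub> indicator T) x =
      int l * (1 - indicator {\<one>} x))"
proof -
  interpret R: ring "group_ring G" by (rule ring_group_ring) fact
  have one: "\<one>\<^bsub>group_ring G\<^esub> = indicator {\<one>}" by (simp add: group_ring_def)
  have "[l] \<cdot>\<^bsub>group_ring G\<^esub> (indicator (carrier G) \<ominus>\<^bsub>group_ring G\<^esub> \<one>\<^bsub>group_ring G\<^esub>) =
      (\<lambda>x. int l * (indicator (carrier G) x - indicator {\<one>} x))"
    using group_ring_a_minus[OF fin indicator_in_group_ring[OF subset_refl] R.one_closed]
    by (simp add: group_ring_add_pow_nat one)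
  moreover have "(indicator S \<otimes>\<^bsub>group_ring G\<^esub> indicator T =
        (\<lambda>x. int l * (indicator (carrier G) x - indicator {\<one>} x))) \<longleftrightarrow>
      (\<forall>x\<in>carrier G. (indicator S \<otimes>\<^bsub>group_ring G\<^esub> indicator T) x =
        int l * (1 - indicator {\<one>} x))"
    using group_ring_mult_outside[OF is_group]
    by (fastforce simp: fun_eq_iff indicator_def)
  ultimately show ?thesis by (simp add: near_factorization_def)
qed

text \<open>The case split is there because integer multiples of \<open>indicator D\<close> are
  evaluated pointwise only for members of the group ring; if the inclusion fails, both sides are
  false.\<close>

lemma partial_difference_set_iff:
  assumes fin: "finite (carrier G)"
  shows "partial_difference_set G v k \<alpha> \<mu> D \<longleftrightarrow>
    order G = v \<and> D \<subseteq> carrier G - {\<one>} \<and> card D = k \<and>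
    (\<forall>x\<in>carrier G. (indicator D \<otimes>\<^bsub>group_ring G\<^esub> indicator (set_inv D)) x =
      (int k - \<mu>) * indicator {\<one>} x + (\<alpha> - \<mu>) * indicator D x + \<mu>)"
proof (cases "D \<subseteq> carrier G - {\<one>}")
  case True
  then have D: "D \<subseteq> carrier G" by auto
  interpret R: ring "group_ring G" by (rule ring_group_ring) fact
  have one: "\<one>\<^bsub>group_ring G\<^esub> = indicator {\<one>}" by (simp add: group_ring_def)
  have add: "f \<oplus>\<^bsub>group_ring G\<^esub> h = (\<lambda>x. f x + h x)" for f h by (simp add: group_ring_def)
  have "[(int k - \<mu>)] \<cdot>\<^bsub>group_ring G\<^esub> \<one>\<^bsub>group_ring G\<^esub>
      \<oplus>\<^bsub>group_ring G\<^esub> [(\<alpha> - \<mu>)] \<cdot>\<^bsub>group_ring G\<^esub> indicator D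
      \<oplus>\<^bsub>group_ring G\<^esub> [\<mu>] \<cdot>\<^bsub>group_ring G\<^esub> indicator (carrier G) =
      (\<lambda>x. (int k - \<mu>) * indicator {\<one>} x + (\<alpha> - \<mu>) * indicator D x
        + \<mu> * indicator (carrier G) x)" (is "?rhs = ?f")
    unfolding group_ring_add_pow_int[OF fin R.one_closed]
      group_ring_add_pow_int[OF fin indicator_in_group_ring[OF D]]
      group_ring_add_pow_int[OF fin indicator_in_group_ring[OF subset_refl]]
    unfolding one add ..
  moreover have "(indicator D \<otimes>\<^bsub>group_ring G\<^esub> indicator (set_inv D) = ?f) \<longleftrightarrow>
    (\<forall>x\<in>carrier G. (indicator D \<otimes>\<^bsub>group_ring G\<^esub> indicator (set_inv D)) x =
      (int k - \<mu>) * indicator {\<one>} x + (\<alpha> - \<mu>) * indicator D x + \<mu>)" (is "?L \<longleftrightarrow> ?R")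
  proof
    assume ?L
    then show ?R by simp
  next
    assume R: ?R
    show ?L
    proof
      fix x
      show "(indicator D \<otimes>\<^bsub>group_ring G\<^esub> indicator (set_inv D)) x = ?f x"
      proof (cases "x \<in> carrier G")
        case False
        moreover from False have "x \<noteq> \<one>" "x \<notin> D" using D by auto
        ultimately show ?thesis by (simp add: group_ring_mult_outside[OF is_group])
      qed (use R in simp)
    qed
  qed
  ultimately show ?thesis by (simp add: partial_difference_set_def)
qed (simp add: partial_difference_set_def)

section \<open>Behaviour under inversion\<close>

text \<open>The prescribed coefficient at \<open>x\<close> depends only on whether \<open>x\<close>
  is the identity, which inversion preserves. As the factors swap, a result about the first factor
  becomes one about the second.\<close>

lemma near_factorization_set_inv:
  assumes "finite (carrier G)" "near_factorization G s t l S T"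
  shows "near_factorization G t s l (set_inv T) (set_inv S)"
proof -
  note nf = assms(2)[unfolded near_factorization_iff[OF assms(1)]]
  then have S: "S \<subseteq> carrier G" and T: "T \<subseteq> carrier G" by auto
  have "(indicator (set_inv T) \<otimes>\<^bsub>group_ring G\<^esub> indicator (set_inv S)) x =
      int l * (1 - indicator {\<one>} x)" if "x \<in> carrier G" for x
    using nf that by (simp add: group_ring_mult_set_inv[OF assms(1) S T] indicator_def)
  then show ?thesis
    using nf S T by (simp add: near_factorization_iff[OF assms(1)] set_inv_subset card_set_inv)
qed

text \<open>The product of \<open>D\<close> and \<open>set_inv D\<close>, the identity and the whole
  group are fixed by inversion. Hence so is the multiple \<alpha> - \<mu> of \<open>D\<close>, and
  the nonzero factor cancels.\<close>

lemma partial_difference_set_set_inv_eq: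
  assumes fin: "finite (carrier G)" and "\<alpha> \<noteq> \<mu>"
    and D: "partial_difference_set G v k \<alpha> \<mu> D"
  shows "set_inv D = D"
proof -
  have sub: "D \<subseteq> carrier G"
    and eq: "\<And>x. x \<in> carrier G \<Longrightarrow>
      (indicator D \<otimes>\<^bsub>group_ring G\<^esub> indicator (set_inv D)) x =
        (int k - \<mu>) * indicator {\<one>} x + (\<alpha> - \<mu>) * indicator D x + \<mu>"
    using D by (auto simp: partial_difference_set_iff[OF fin])
  have "inv x \<in> D \<longleftrightarrow> x \<in> D" if x: "x \<in> carrier G" for x
  proof -
    have "(indicator D \<otimes>\<^bsub>group_ring G\<^esub> indicator (set_inv D)) x =
        (indicator D \<otimes>\<^bsub>group_ring G\<^esub> indicator (set_inv D)) (inv x)"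
      using group_ring_mult_set_inv[OF fin sub set_inv_subset[OF sub] x]
      by (simp add: set_inv_set_inv[OF sub])
    moreover have "indicator {\<one>} (inv x) = (indicator {\<one>} x :: int)"
      using x by (simp add: indicator_def)
    ultimately have "(\<alpha> - \<mu>) * indicator D (inv x) = (\<alpha> - \<mu>) * indicator D x"
      using eq[OF x] eq[of "inv x"] x by auto
    then show ?thesis
      using \<open>\<alpha> \<noteq> \<mu>\<close> by (auto simp: indicator_def split: if_splits)
  qed
  then have "x \<in> set_inv D \<longleftrightarrow> x \<in> D" if "x \<in> carrier G" for x
    using that by (simp add: mem_set_inv_iff[OF sub])
  then show ?thesis
    using sub set_inv_subset[OF sub] by auto
qed

section \<open>From a near-factorization to a partial difference set\<close>

text \<open>Counting leaves a single element \<open>g\<close> outside \<open>set_inv S\<close> and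
  \<open>T\<close>. That \<open>inv g\<close> is not in \<open>S\<close> later keeps the identity
  out of \<open>S #> g\<close>.\<close>

lemma near_factorization_partition:
  assumes fin: "finite (carrier G)"
    and ST: "near_factorization G s t l S T"
    and v: "order G = s + t + 1"
  obtains g where "g \<in> carrier G" "inv g \<notin> S"
    "\<And>x. x \<in> carrier G \<Longrightarrow>
      indicator (set_inv S) x = 1 - indicator T x - (indicator {g} x :: int)"
proof -
  note nf = ST[unfolded near_factorization_iff[OF fin]]
  have S: "S \<subseteq> carrier G" and T: "T \<subseteq> carrier G" using nf by auto
  \<comment> \<open>This is the coefficient of the product at the identity; being a sum of
    nonnegative terms, it forces each term to vanish.\<close>
  have "(\<Sum>a\<in>S. indicator T (inv a \<otimes> \<one>)) = (0 :: int)"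
    using nf fin by (simp flip: group_ring_mult_indicator_sum)
  moreover have "finite S" using S fin finite_subset by blast
  ultimately have "inv a \<notin> T" if "a \<in> S" for a
    using that S by (auto simp: sum_nonneg_eq_0_iff indicator_def subset_iff split: if_splits)
  then have disj: "set_inv S \<inter> T = {}" by (auto simp: SET_INV_def)
  have "finite (set_inv S \<union> T)"
    using fin T set_inv_subset[OF S] finite_subset by blast
  then have "card (set_inv S \<union> T) = s + t"
    using disj nf by (simp add: card_Un_disjoint card_set_inv)
  then have "card (carrier G - (set_inv S \<union> T)) = 1"
    using v \<open>finite (set_inv S \<union> T)\<close> T set_inv_subset[OF S]
    by (simp add: card_Diff_subset order_def)
  then obtain g where g: "carrier G - (set_inv S \<union> T) = {g}" by (auto simp: card_1_singleton_iff)
  show thesis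
  proof
    show "g \<in> carrier G" using g by blast
    then show "inv g \<notin> S" using g mem_set_inv_iff[OF S] by blast
    show "indicator (set_inv S) x = 1 - indicator T x - (indicator {g} x :: int)"
      if "x \<in> carrier G" for x
    proof -
      have "x \<in> set_inv S \<longleftrightarrow> x \<notin> T \<and> x \<noteq> g" using that g disj by blast
      moreover have "g \<notin> T" using g by blast
      ultimately show ?thesis by (auto simp: indicator_def)
    qed
  qed
qed

text \<open>The parameters give \<alpha> - \<mu> = -1 and \<open>l\<close> as the coefficient of the
  identity, as the expansion of the product of \<open>S\<close> and \<open>set_inv S\<close>
  requires.\<close>

lemma near_factorization_partial_difference_set:
  assumes fin: "finite (carrier G)"
    and ST: "near_factorization G s t l S T"
    and v: "order G = s + t + 1"
  obtains g where "g \<in> carrier G"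
    "partial_difference_set G (s + t + 1) s (int s - int l - 1) (int s - int l) (S #> g)"
proof -
  note nf = ST[unfolded near_factorization_iff[OF fin]]
  have S: "S \<subseteq> carrier G" using nf by auto
  obtain g where g: "g \<in> carrier G" "inv g \<notin> S"
    and compl: "\<And>x. x \<in> carrier G \<Longrightarrow>
      indicator (set_inv S) x = 1 - indicator T x - (indicator {g} x :: int)"
    using near_factorization_partition[OF fin ST v] by blast
  let ?D = "S #> g"
  have D: "?D \<subseteq> carrier G" using S g(1) by (rule r_coset_subset_G)
  have "\<one> \<notin> ?D" using g S by (simp add: mem_r_coset_iff)
  moreover have "card ?D = s"
    using nf inj_on_r_translation[OF S g(1)] by (simp add: r_coset_eq_image card_image)
  moreover have "(indicator ?D \<otimes>\<^bsub>group_ring G\<^esub> indicator (set_inv ?D)) x =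
      int l * indicator {\<one>} x - indicator ?D x + (int s - int l)" if x: "x \<in> carrier G" for x
  proof -
    \<comment> \<open>Elements of \<open>S #> g\<close> are written as \<open>a \<otimes> g\<close>
      with \<open>a\<close> in \<open>S\<close>; next, \<open>g\<close> cancels against the
      translation by \<open>inv g\<close> in \<open>set_inv ?D\<close>.\<close>
    have "(indicator ?D \<otimes>\<^bsub>group_ring G\<^esub> indicator (set_inv ?D)) x =
        (\<Sum>a\<in>S. indicator (set_inv ?D) (inv (a \<otimes> g) \<otimes> x))"
      using inj_on_r_translation[OF S g(1)]
      by (simp add: group_ring_mult_indicator_sum[OF fin D x])
        (simp add: r_coset_eq_image sum.reindex)
    also have "\<dots> = (\<Sum>a\<in>S. indicator (set_inv S) (inv a \<otimes> x))"
    proof (rule sum.cong[OF refl])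
      fix a assume "a \<in> S"
      then have a: "a \<in> carrier G" using S by auto
      have "g \<otimes> (inv g \<otimes> (inv a \<otimes> x)) = inv a \<otimes> x"
        using a g x by (simp add: m_assoc[symmetric])
      then have "inv (a \<otimes> g) \<otimes> x \<in> set_inv ?D \<longleftrightarrow> inv a \<otimes> x \<in> set_inv S"
        using a g x S
        by (simp add: set_inv_r_coset mem_l_coset_iff set_inv_subset inv_mult_group m_assoc)
      then show "indicator (set_inv ?D) (inv (a \<otimes> g) \<otimes> x)
          = (indicator (set_inv S) (inv a \<otimes> x) :: int)"
        by (simp add: indicator_def)
    qed
    also have "\<dots> = (\<Sum>a\<in>S. 1 - indicator T (inv a \<otimes> x) - indicator {g} (inv a \<otimes> x))"
      using S x by (intro sum.cong) (auto simp: compl subset_iff)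
    also have "\<dots> = int s - (indicator S \<otimes>\<^bsub>group_ring G\<^esub> indicator T) x
        - (\<Sum>a\<in>S. indicator {g} (inv a \<otimes> x))"
      using nf x by (simp add: group_ring_mult_indicator_sum[OF fin S] sum_subtractf)
    \<comment> \<open>The only candidate for a nonzero term is \<open>a = x \<otimes> inv g\<close>,
      which lies in \<open>S\<close> exactly when \<open>x\<close> lies in
      \<open>S #> g\<close>.\<close>
    also have "(\<Sum>a\<in>S. indicator {g} (inv a \<otimes> x)) =
        (\<Sum>a\<in>S. if a = x \<otimes> inv g then 1 else (0 :: int))"
    proof (rule sum.cong[OF refl])
      fix a assume "a \<in> S"
      then have a: "a \<in> carrier G" using S by auto
      have "inv a \<otimes> x = g \<longleftrightarrow> a = x \<otimes> inv g"
        using a g x by (metis inv_solve_left inv_solve_right)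
      then show "indicator {g} (inv a \<otimes> x) = (if a = x \<otimes> inv g then 1 else (0 :: int))"
        by (simp add: indicator_def)
    qed
    also have "\<dots> = indicator ?D x"
      using S g x finite_subset[OF S fin] by (simp add: mem_r_coset_iff indicator_def)
    finally show ?thesis using nf x by (simp add: algebra_simps)
  qed
  ultimately have "partial_difference_set G (s + t + 1) s (int s - int l - 1) (int s - int l) ?D"
    using D v by (auto simp: partial_difference_set_iff[OF fin])
  with g(1) show thesis by (rule that)
qed

end

theorem theorem2p14:
  fixes G :: "('a, 'b) monoid_scheme" and S T :: "'a set" and s t l :: nat
  assumes "group G" and "finite (carrier G)"
    and "near_factorization G s t l S T"
    and "order G = s + t + 1"
  shows "(\<exists>D. partial_difference_set G (s + t + 1) s (int s - int l - 1) (int s - int l) D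
              \<and> translate_equivalent G S D)
       \<and> (\<exists>D. partial_difference_set G (s + t + 1) t (int t - int l - 1) (int t - int l) D
              \<and> translate_equivalent G T D)"
proof -
  interpret group G by fact
  have S: "S \<subseteq> carrier G" and T: "T \<subseteq> carrier G"
    using assms(3) by (auto simp: near_factorization_def)
  obtain g where g: "g \<in> carrier G"
    and D: "partial_difference_set G (s + t + 1) s (int s - int l - 1) (int s - int l) (S #>\<^bsub>G\<^esub> g)"
    using near_factorization_partial_difference_set[OF assms(2-4)] .
  \<comment> \<open>\<open>S\<close> has to be a translate of the difference set, so the translation
    by \<open>g\<close> is undone.\<close>
  have "S = (S #>\<^bsub>G\<^esub> g) #>\<^bsub>G\<^esub> inv\<^bsub>G\<^esub> g"
    using S g by (simp add: coset_mult_assoc)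
  then have S_equiv: "translate_equivalent G S (S #>\<^bsub>G\<^esub> g)"
    unfolding translate_equivalent_def using g by blast
  have v: "order G = t + s + 1" using assms(4) by simp
  obtain h where h: "h \<in> carrier G"
    and "partial_difference_set G (t + s + 1) t (int t - int l - 1) (int t - int l)
      (set_inv\<^bsub>G\<^esub> T #>\<^bsub>G\<^esub> h)"
    using near_factorization_partial_difference_set[OF assms(2)
        near_factorization_set_inv[OF assms(2,3)] v] .
  then have E: "partial_difference_set G (s + t + 1) t (int t - int l - 1) (int t - int l)
      (set_inv\<^bsub>G\<^esub> T #>\<^bsub>G\<^esub> h)"
    by (simp add: add.commute)
  \<comment> \<open>Here \<alpha> - \<mu> = -1 is nonzero, so the set equals its inverse; this
    passes from a translate of \<open>set_inv T\<close> to one of \<open>T\<close>.\<close>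
  have "set_inv\<^bsub>G\<^esub> T #>\<^bsub>G\<^esub> h = set_inv\<^bsub>G\<^esub> (set_inv\<^bsub>G\<^esub> T #>\<^bsub>G\<^esub> h)"
    using partial_difference_set_set_inv_eq[OF assms(2) _ E] by simp
  also have "\<dots> = inv\<^bsub>G\<^esub> h <#\<^bsub>G\<^esub> T"
    using T h by (simp add: set_inv_r_coset set_inv_subset set_inv_set_inv)
  finally have "T = h <#\<^bsub>G\<^esub> (set_inv\<^bsub>G\<^esub> T #>\<^bsub>G\<^esub> h)"
    using T h by (simp add: lcos_m_assoc lcos_mult_one)
  then have "translate_equivalent G T (set_inv\<^bsub>G\<^esub> T #>\<^bsub>G\<^esub> h)"
    unfolding translate_equivalent_def using h by blast
  with D S_equiv E show ?thesis by blast
qed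

end
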